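(* Let $0<q\le 1$ and let $w\in S_n$ be Mallows distributed with parameter $q$. Let $\lambda=(n-1)q/(1+q)$ and let $N$ be a Poisson random variable with mean $\lambda$. Then $$d_{TV}\left(\mathrm{des}(w)+\mathrm{des}(w^{-1}),\,2N\right)\le 12q^2n.$$
   Context: For $w\in S_n$ (a permutation of $[n]=\{1,\dots,n\}$), $l(w)$ is the number of inversions, i.e. pairs $i<j$ in $[n]$ with $w(i)>w(j)$. A random $w\in S_n$ is Mallows distributed with parameter $q$ if $\mathbf{P}(w=w_0)$ is proportional to $q^{l(w_0)}$ for $w_0\in S_n$. The number of descents is $\mathrm{des}(w)=\#\{i\in\{1,\dots,n-1\}: w(i)>w(i+1)\}$. $d_{TV}(X,Y)$ denotes the total variation distance $\sup_A|\mathbf{P}(X\in A)-\mathbf{P}(Y\in A)|$ between the laws of $X$ and $Y$. *)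

theory Defs
  imports "HOL-Probability.Probability" "HOL-Combinatorics.Permutations"
begin

text \<open>A permutation of \<open>{1..n}\<close> is a function \<open>w :: nat \<Rightarrow> nat\<close> with
  \<open>w permutes {1..n}\<close>, i.e. it is extended by the identity outside \<open>{1..n}\<close>;
  its inverse permutation is then \<open>inv w\<close>.\<close>

definition inversion_number :: "nat \<Rightarrow> (nat \<Rightarrow> nat) \<Rightarrow> nat" where
  "inversion_number n w = card {(i, j). i \<in> {1..n} \<and> j \<in> {1..n} \<and> i < j \<and> w i > w j}"

definition des :: "nat \<Rightarrow> (nat \<Rightarrow> nat) \<Rightarrow> nat" where
  "des n w = card {i \<in> {1..n - 1}. w i > w (i + 1)}"

text \<open>The constant of proportionality \<open>c\<close> is determined by the total mass being \<open>1\<close>,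
  since the measurability condition includes that \<open>w\<close> takes values in the permutations
  of \<open>{1..n}\<close> only.\<close>

definition mallows_distributed ::
    "'a measure \<Rightarrow> nat \<Rightarrow> real \<Rightarrow> ('a \<Rightarrow> nat \<Rightarrow> nat) \<Rightarrow> bool" where
  "mallows_distributed M n q w \<longleftrightarrow>
     w \<in> measurable M (count_space {p. p permutes {1..n}}) \<and>
     (\<exists>c. \<forall>p. p permutes {1..n} \<longrightarrow>
        measure M {x \<in> space M. w x = p} = c * q ^ inversion_number n p)"

text \<open>The library's \<^const>\<open>poisson_pmf\<close> is specified for positive rates only. Here mean \<open>0\<close>
  (almost surely \<open>N = 0\<close>) has to be allowed as well, which \<open>0 ^ 0 = 1\<close> takes care of.\<close>

definition poisson_distributed :: "'a measure \<Rightarrow> real \<Rightarrow> ('a \<Rightarrow> nat) \<Rightarrow> bool" where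
  "poisson_distributed M l N \<longleftrightarrow>
     N \<in> measurable M (count_space UNIV) \<and>
     (\<forall>k. measure M {x \<in> space M. N x = k} = l ^ k / fact k * exp (- l))"

text \<open>Meant for probability measures with \<open>sets P = sets Q\<close>.\<close>

definition tv_dist :: "'a measure \<Rightarrow> 'a measure \<Rightarrow> real" where
  "tv_dist P Q = (SUP A\<in>sets P. \<bar>measure P A - measure Q A\<bar>)"

end

theory Submission
  imports Defs
begin

text \<open>Since the total variation distance is \<open>sup\<^sub>A (P(Y \<in> A) - P(X \<in> A))\<close>, it is bounded by the
  sum over \<open>k\<close> of the positive parts of \<open>P(N = k) - P(des(w) + des(w\<inverse>) = 2k)\<close>, so lower bounds on
  the latter probabilities suffice. A product of \<open>k\<close> distinct commuting
  simple transpositions is an involution with \<open>k\<close> inversions and \<open>k\<close> descents. There are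
  \<open>(n - k) choose k\<close> of these, each of probability \<open>q\<^sup>k / Z\<close> where the normalising constant satisfies
  \<open>Z \<le> (1 - q)\<^sup>-\<^sup>(\<^sup>n\<^sup>-\<^sup>1\<^sup>)\<close>. Comparing with the Poisson weights, the relative defect at \<open>k\<close> is at most
  \<open>2 (n - 1) q\<^sup>2 + 3 k (k - 1) / (2 (n - 1))\<close>, whose Poisson mean is at most \<open>7/2 (n - 1) q\<^sup>2\<close>.\<close>

section \<open>Products of commuting simple transpositions\<close>

definition sparse_sets :: "nat \<Rightarrow> nat \<Rightarrow> nat set set" where
  "sparse_sets n k = {S. S \<subseteq> {1..<n} \<and> card S = k \<and> (\<forall>i\<in>S. Suc i \<notin> S)}"

text \<open>This is the product of the transpositions \<open>(i, Suc i)\<close> with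
  \<open>i \<in> S\<close>. For a sparse \<open>S\<close> their supports are disjoint, so the order
  of the factors is immaterial.\<close>

definition swap_perm :: "nat set \<Rightarrow> nat \<Rightarrow> nat" where
  "swap_perm S i = (if i \<in> S then Suc i else if i > 0 \<and> i - 1 \<in> S then i - 1 else i)"

lemma finite_sparse_sets: "finite (sparse_sets n k)"
  unfolding sparse_sets_def by (rule finite_subset[of _ "Pow {1..<n}"]) auto

text \<open>Split by whether the largest admissible position belongs to the set: if it does, the
  position before it is excluded, and the two cases add up as in Pascal's rule. One inclusion
  suffices for a lower bound.\<close>

lemma card_sparse_sets_ge: "(n - k) choose k \<le> card (sparse_sets n k)"
proof (induction n arbitrary: k rule: induct_nat_012)
  case 0
  show ?case
  proof (cases k)
    case 0
    then have "sparse_sets 0 k = {{}}" by (auto simp: sparse_sets_def)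
    then show ?thesis using 0 by simp
  qed simp
next
  case 1
  show ?case
  proof (cases k)
    case 0
    then have "sparse_sets (Suc 0) k = {{}}" by (auto simp: sparse_sets_def)
    then show ?thesis using 0 by simp
  qed simp
next
  case (ge2 n)
  show ?case
  proof (cases k)
    case 0
    then have "sparse_sets (Suc (Suc n)) k = {{}}"
      by (auto simp: sparse_sets_def card_eq_0_iff dest: finite_subset)
    then show ?thesis using 0 by simp
  next
    case (Suc j)
    let ?A = "sparse_sets (Suc n) (Suc j)" and ?B = "insert (Suc n) ` sparse_sets n j"
    have notin: "Suc n \<notin> S" if "S \<in> ?A \<or> S \<in> sparse_sets n j" for S
      using that by (auto simp: sparse_sets_def)
    have disj: "?A \<inter> ?B = {}"
      using notin by blast
    have inj: "inj_on (insert (Suc n)) (sparse_sets n j)"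
      using notin by (intro inj_onI) (metis insert_ident)
    have sub: "?A \<union> ?B \<subseteq> sparse_sets (Suc (Suc n)) (Suc j)"
    proof
      fix T assume "T \<in> ?A \<union> ?B"
      then show "T \<in> sparse_sets (Suc (Suc n)) (Suc j)"
      proof
        assume "T \<in> ?A"
        then show ?thesis by (fastforce simp: sparse_sets_def)
      next
        assume "T \<in> ?B"
        then obtain S where S: "S \<in> sparse_sets n j" "T = insert (Suc n) S" by blast
        have "finite S" using S(1) finite_subset by (auto simp: sparse_sets_def)
        then show ?thesis using S notin[of S] by (fastforce simp: sparse_sets_def)
      qed
    qed
    \<comment> \<open>Pascal's rule if \<open>j \<le> n\<close>. For \<open>j > n\<close> truncated
      subtraction turns the left side into \<open>0 choose Suc j\<close>, which is 0.\<close>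
    have "(Suc (Suc n) - Suc j) choose Suc j \<le> ((Suc n - Suc j) choose Suc j) + ((n - j) choose j)"
      by (cases "j \<le> n") (auto simp: Suc_diff_le not_le)
    also have "\<dots> \<le> card ?A + card (sparse_sets n j)"
      using ge2(1)[of j] ge2(2)[of "Suc j"] by linarith
    also have "\<dots> = card (?A \<union> ?B)"
      using disj inj by (simp add: card_Un_disjoint finite_sparse_sets card_image)
    also have "\<dots> \<le> card (sparse_sets (Suc (Suc n)) (Suc j))"
      by (intro card_mono finite_sparse_sets sub)
    finally show ?thesis using Suc by simp
  qed
qed

context
  fixes n k S
  assumes S: "S \<in> sparse_sets n k"
begin

lemma sparse_Suc_notin: "i \<in> S \<Longrightarrow> Suc i \<notin> S"
  using S by (auto simp: sparse_sets_def)

lemma sparse_bounds: "i \<in> S \<Longrightarrow> 1 \<le> i \<and> i < n"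
  using S by (auto simp: sparse_sets_def)

lemma swap_perm_swap_perm: "swap_perm S (swap_perm S i) = i"
  using sparse_Suc_notin[of i] sparse_Suc_notin[of "i - 1"]
  by (auto simp: swap_perm_def)

lemma swap_perm_permutes: "swap_perm S permutes {1..n}"
proof -
  have "swap_perm S i = i" if "i \<notin> {1..n}" for i
    using that sparse_bounds[of i] sparse_bounds[of "i - 1"] by (auto simp: swap_perm_def)
  moreover have "\<exists>!j. swap_perm S j = i" for i
    by (metis swap_perm_swap_perm)
  ultimately show ?thesis by (auto simp: permutes_def)
qed

lemma inv_swap_perm: "inv (swap_perm S) = swap_perm S"
  by (rule inv_equality) (simp_all add: swap_perm_swap_perm)

lemma swap_perm_descent_iff: "swap_perm S i > swap_perm S (Suc i) \<longleftrightarrow> i \<in> S"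
  using sparse_Suc_notin[of i] by (auto simp: swap_perm_def)

text \<open>Each point moves by at most one, so positions at distance two or more keep their weak
  order; an inversion must be a descent.\<close>

lemma swap_perm_inversion_iff:
  "i < j \<and> swap_perm S i > swap_perm S j \<longleftrightarrow> i \<in> S \<and> j = Suc i"
proof
  assume *: "i < j \<and> swap_perm S i > swap_perm S j"
  moreover have "swap_perm S i \<le> Suc i" "j - 1 \<le> swap_perm S j"
    by (auto simp: swap_perm_def)
  ultimately have "j = Suc i" by linarith
  then show "i \<in> S \<and> j = Suc i" using * swap_perm_descent_iff by blast
qed (use swap_perm_descent_iff in auto)

lemma inversion_number_swap_perm: "inversion_number n (swap_perm S) = k"
proof -
  have "{(i, j). i \<in> {1..n} \<and> j \<in> {1..n} \<and> i < j \<and> swap_perm S i > swap_perm S j}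
      = (\<lambda>i. (i, Suc i)) ` S"
    using swap_perm_inversion_iff sparse_bounds by fastforce
  then have "inversion_number n (swap_perm S) = card S"
    by (simp add: inversion_number_def card_image inj_on_def)
  then show ?thesis using S by (simp add: sparse_sets_def)
qed

lemma des_swap_perm: "des n (swap_perm S) = k"
proof -
  have "{i \<in> {1..n - 1}. swap_perm S i > swap_perm S (i + 1)} = S"
    using swap_perm_descent_iff sparse_bounds by fastforce
  then show ?thesis using S by (simp add: des_def sparse_sets_def)
qed

end

lemma inj_on_swap_perm: "inj_on swap_perm (sparse_sets n k)"
proof (rule inj_onI)
  fix S T assume "S \<in> sparse_sets n k" "T \<in> sparse_sets n k" "swap_perm S = swap_perm T"
  then show "S = T" using swap_perm_descent_iff by (metis subsetI subset_antisym)
qed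

section \<open>Binomial coefficients against powers\<close>

text \<open>Weierstrass' product inequality. For infinite \<open>I\<close> the default values of sum
  and product turn it into \<open>1 \<le> 1\<close>.\<close>

lemma one_minus_sum_le_prod:
  fixes x :: "'a \<Rightarrow> real"
  assumes "\<And>i. i \<in> I \<Longrightarrow> x i \<in> {0..1}"
  shows "1 - sum x I \<le> (\<Prod>i\<in>I. 1 - x i)"
proof (cases "finite I")
  case True
  then show ?thesis using assms
  proof (induction I)
    case (insert a I)
    have "0 \<le> sum x I" using insert.prems by (intro sum_nonneg) auto
    then have "1 - sum x (insert a I) \<le> (1 - x a) * (1 - sum x I)"
      using insert by (simp add: algebra_simps)
    also have "\<dots> \<le> (1 - x a) * (\<Prod>i\<in>I. 1 - x i)"
      using insert by (intro mult_left_mono) auto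
    finally show ?case using insert.hyps by simp
  qed simp
qed simp

text \<open>The right side is the product of \<open>n - k - i\<close> over \<open>i < k\<close>, and
  each factor is \<open>n - 1\<close> times \<open>1 - (k + i - 1) / (n - 1)\<close>. The product
  inequality applies, and the numerators \<open>k + i - 1\<close> sum to
  \<open>3 / 2 * k * (k - 1)\<close>.\<close>

lemma prod_diff_ge:
  fixes n k :: nat
  assumes "n \<ge> 2"
  shows "(1 - 3 / 2 * real k * (real k - 1) / (real n - 1)) * (real n - 1) ^ k
    \<le> real ((n - k) choose k) * fact k"
proof (cases "3 / 2 * real k * (real k - 1) / (real n - 1) \<ge> 1 \<or> k = 0")
  case True
  then show ?thesis
  proof
    assume "3 / 2 * real k * (real k - 1) / (real n - 1) \<ge> 1"
    then have "(1 - 3 / 2 * real k * (real k - 1) / (real n - 1)) * (real n - 1) ^ k \<le> 0"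
      using assms by (intro mult_nonpos_nonneg) auto
    then show ?thesis by (rule order_trans) simp
  qed simp
next
  case False
  let ?x = "\<lambda>i. (real k + real i - 1) / (real n - 1)"
  from False have k: "k \<ge> 1" by simp
  have pos: "real n - 1 > 0" using assms by simp
  have lt: "3 / 2 * real k * (real k - 1) < real n - 1"
    using False pos by (simp add: field_simps)
  \<comment> \<open>This keeps every \<open>?x i\<close> at most 1 and makes the natural subtraction
    \<open>n - k\<close> a true one.\<close>
  have kn: "2 * k \<le> n"
  proof (cases "k = 1")
    case True then show ?thesis using assms by simp
  next
    case False
    then have "2 \<le> real k" using k by simp
    then have "3 / 2 * real k * (real k - 1) \<ge> 3 / 2 * 2 * (real k - 1)"
      by (intro mult_right_mono) auto
    then have "3 * (real k - 1) < real n - 1" using lt by simp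
    then have "real (3 * k) < real (n + 2)" by simp
    then have "3 * k < n + 2" by (simp only: of_nat_less_iff)
    then show ?thesis using False k by linarith
  qed
  have sum: "(\<Sum>i<k. ?x i) = 3 / 2 * real k * (real k - 1) / (real n - 1)"
  proof -
    \<comment> \<open>The number of terms is generalised to \<open>m\<close> for the induction,
      because \<open>k\<close> also occurs in the summand.\<close>
    have "(\<Sum>i<m. real k + real i - 1) = real m * (real k - 1) + real m * (real m - 1) / 2" for m
      by (induction m) (auto simp: field_simps)
    from this[of k] show ?thesis
      by (simp only: sum_divide_distrib[symmetric]) (simp add: field_simps)
  qed
  have x: "?x i \<in> {0..1}" if "i < k" for i
    using that kn k pos by (auto simp: field_simps)
  have "1 - (\<Sum>i<k. ?x i) \<le> (\<Prod>i<k. 1 - ?x i)"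
    using x by (intro one_minus_sum_le_prod) auto
  then have "(1 - 3 / 2 * real k * (real k - 1) / (real n - 1)) * (real n - 1) ^ k
      \<le> (\<Prod>i<k. 1 - ?x i) * (real n - 1) ^ k"
    unfolding sum using pos by (intro mult_right_mono) auto
  also have "\<dots> = (\<Prod>i<k. (1 - ?x i) * (real n - 1))"
    by (simp add: prod.distrib)
  also have "\<dots> = (\<Prod>i<k. real (n - k) - real i)"
    using kn pos by (intro prod.cong) (auto simp: field_simps of_nat_diff)
  also have "\<dots> = real ((n - k) choose k) * fact k"
    by (simp add: binomial_gbinomial gbinomial_prod_rev atLeast0LessThan)
  finally show ?thesis .
qed

section \<open>The normalising constant and its exponential comparison\<close>

text \<open>Composing \<open>w\<close> with this cycle, where \<open>b = w (Suc n)\<close> and \<open>m = Suc n\<close>, standardises the word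
  \<open>w 1 \<dots> w n\<close> to a permutation of \<open>{1..n}\<close>.\<close>
definition shift_cycle :: "nat \<Rightarrow> nat \<Rightarrow> nat \<Rightarrow> nat" where
  "shift_cycle m b x = (if x = b then m else if b < x \<and> x \<le> m then x - 1 else x)"

lemma shift_cycle_permutes:
  assumes "b \<in> {1..m}"
  shows "shift_cycle m b permutes {1..m}"
proof (rule bij_imp_permutes)
  have inj: "inj_on (shift_cycle m b) {1..m}"
    using assms by (auto simp: inj_on_def shift_cycle_def split: if_splits)
  have "shift_cycle m b ` {1..m} \<subseteq> {1..m}"
    using assms by (auto simp: shift_cycle_def)
  then show "bij_betw (shift_cycle m b) {1..m} {1..m}"
    using inj by (simp add: bij_betw_def endo_inj_surj)
qed (use assms in \<open>auto simp: shift_cycle_def\<close>)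

lemma shift_cycle_less_iff:
  assumes "x \<in> {1..m}" "y \<in> {1..m}" "x \<noteq> b" "y \<noteq> b"
  shows "shift_cycle m b x < shift_cycle m b y \<longleftrightarrow> x < y"
  using assms by (auto simp: shift_cycle_def)

lemma shift_cycle_comp_permutes:
  assumes w: "w permutes {1..Suc n}"
  shows "shift_cycle (Suc n) (w (Suc n)) \<circ> w permutes {1..n}"
proof -
  let ?p = "shift_cycle (Suc n) (w (Suc n)) \<circ> w"
  have "w (Suc n) \<in> {1..Suc n}"
    using permutes_in_image[OF w, of "Suc n"] by simp
  then have "?p permutes {1..Suc n}"
    by (intro permutes_compose w shift_cycle_permutes)
  then show ?thesis
  proof (rule permutes_superset)
    fix x assume "x \<in> {1..Suc n} - {1..n}"
    then have "x = Suc n" by auto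
    then show "?p x = x" by (simp add: shift_cycle_def)
  qed
qed

text \<open>Standardising preserves the relative order of the first \<open>n\<close> values. The
  inversions involving the last position correspond to the values exceeding
  \<open>w (Suc n)\<close>, all of which occur earlier.\<close>

lemma inversion_number_Suc:
  assumes w: "w permutes {1..Suc n}"
  shows "inversion_number (Suc n) w
    = inversion_number n (shift_cycle (Suc n) (w (Suc n)) \<circ> w) + (Suc n - w (Suc n))"
proof -
  let ?b = "w (Suc n)"
  let ?p = "shift_cycle (Suc n) ?b \<circ> w"
  let ?I = "{(i, j). i \<in> {1..n} \<and> j \<in> {1..n} \<and> i < j \<and> ?p i > ?p j}"
  let ?J = "{i \<in> {1..n}. w i > ?b}"
  have inj: "inj w" using w by (rule permutes_inj)
  have img: "w i \<in> {1..Suc n}" if "i \<in> {1..Suc n}" for i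
    using permutes_in_image[OF w, of i] that by simp
  have less: "?p i > ?p j \<longleftrightarrow> w i > w j" if "i \<in> {1..n}" "j \<in> {1..n}" for i j
    unfolding o_def
  proof (rule shift_cycle_less_iff)
    show "w i \<in> {1..Suc n}" "w j \<in> {1..Suc n}" using that img[of i] img[of j] by auto
    show "w i \<noteq> ?b" "w j \<noteq> ?b" using that injD[OF inj] by fastforce+
  qed
  have "{(i, j). i \<in> {1..Suc n} \<and> j \<in> {1..Suc n} \<and> i < j \<and> w i > w j}
      = ?I \<union> (\<lambda>i. (i, Suc n)) ` ?J" (is "?L = ?R")
  proof (rule set_eqI, clarify)
    fix i j
    show "(i, j) \<in> ?L \<longleftrightarrow> (i, j) \<in> ?R"
      using less[of i j] by (cases "j = Suc n") (auto simp: le_Suc_eq)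
  qed
  moreover have disj: "?I \<inter> (\<lambda>i. (i, Suc n)) ` ?J = {}" by auto
  moreover have inj_pair: "inj_on (\<lambda>i. (i, Suc n)) ?J" by (simp add: inj_on_def)
  moreover have fin: "finite ?J" by simp
  moreover have "finite ?I"
    by (rule finite_subset[of _ "{1..n} \<times> {1..n}"]) auto
  ultimately have "inversion_number (Suc n) w = inversion_number n ?p + card ?J"
    unfolding inversion_number_def by (simp only: card_Un_disjoint[OF _ _ disj] finite_imageI
        finite_Collect_conjI finite_atLeastAtMost card_image[OF inj_pair] Collect_mem_eq fin)
  moreover have "card ?J = card {?b<..Suc n}"
  proof -
    have "w ` ?J = {?b<..Suc n}"
    proof
      show "w ` ?J \<subseteq> {?b<..Suc n}" using img by fastforce
      show "{?b<..Suc n} \<subseteq> w ` ?J"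
      proof
        fix y assume y: "y \<in> {?b<..Suc n}"
        then have "y \<in> w ` {1..Suc n}" using permutes_image[OF w] by simp
        then obtain i where i: "i \<in> {1..Suc n}" "y = w i" by blast
        then have "i \<noteq> Suc n" using y by auto
        then show "y \<in> w ` ?J" using i y by auto
      qed
    qed
    moreover have "inj_on w ?J" using inj by (rule inj_on_subset) simp
    ultimately show ?thesis by (metis card_image)
  qed
  ultimately show ?thesis by simp
qed

text \<open>Recording the last value and the standardised rest embeds the permutations of
  \<open>{1..Suc n}\<close> into a product, over which the sum factors. Each new position
  contributes a truncated geometric series, at most \<open>1 / (1 - q)\<close>; the first position
  contributes only 1, hence the exponent \<open>n\<close>.\<close>

lemma sum_inversions_le:
  fixes q :: real
  assumes "0 < q" "q < 1"
  shows "(\<Sum>p | p permutes {1..Suc n}. q ^ inversion_number (Suc n) p) \<le> (1 / (1 - q)) ^ n"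
proof (induction n)
  case 0
  have "{p. p permutes {1..Suc 0}} = {id}" by simp
  moreover have "inversion_number (Suc 0) id = 0"
  proof -
    have "{(i, j). i \<in> {1..Suc 0} \<and> j \<in> {1..Suc 0} \<and> i < j \<and> id i > id j} = {}"
      by auto
    then show ?thesis unfolding inversion_number_def by (simp only: card.empty)
  qed
  ultimately show ?case by (simp add: id_def)
next
  case (Suc n)
  let ?m = "Suc n"
  let ?P = "{p. p permutes {1..?m}}"
  let ?f = "\<lambda>w. (w (Suc ?m), shift_cycle (Suc ?m) (w (Suc ?m)) \<circ> w)"
  let ?g = "\<lambda>(b, p). q ^ (Suc ?m - b) * q ^ inversion_number ?m p"
  let ?W = "{w. w permutes {1..Suc ?m}}"
  have fin: "finite ?P" by (intro finite_permutations) simp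
  have range: "?f w \<in> {1..Suc ?m} \<times> ?P" if "w \<in> ?W" for w
    using that permutes_in_image[of w "{1..Suc ?m}" "Suc ?m"] shift_cycle_comp_permutes[of w ?m]
    by auto
  have inj: "inj_on ?f ?W"
  proof (rule inj_onI)
    fix v w assume vw: "v \<in> ?W" "w \<in> ?W" "?f v = ?f w"
    \<comment> \<open>Equal last values give the same cycle for \<open>v\<close> and
      \<open>w\<close>, and this cycle can be cancelled.\<close>
    let ?c = "shift_cycle (Suc ?m) (w (Suc ?m))"
    have "?c permutes {1..Suc ?m}"
      using range[OF vw(2)] by (intro shift_cycle_permutes) auto
    then have "inj ?c" by (rule permutes_inj)
    moreover have "?c \<circ> v = ?c \<circ> w" using vw(3) by (metis Pair_inject)
    ultimately show "v = w" by (simp add: inj_def fun_eq_iff)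
  qed
  have "(\<Sum>w\<in>?W. q ^ inversion_number (Suc ?m) w) = (\<Sum>w\<in>?W. ?g (?f w))"
    by (intro sum.cong) (auto simp: inversion_number_Suc power_add)
  also have "\<dots> = (\<Sum>z\<in>?f ` ?W. ?g z)"
    using inj by (simp only: sum.reindex o_def)
  also have "\<dots> \<le> (\<Sum>z\<in>{1..Suc ?m} \<times> ?P. ?g z)"
    using range fin assms by (intro sum_mono2) (blast | auto)+
  also have "\<dots> = (\<Sum>b\<in>{1..Suc ?m}. q ^ (Suc ?m - b)) * (\<Sum>p\<in>?P. q ^ inversion_number ?m p)"
    by (simp only: sum_product sum.cartesian_product)
  also have "\<dots> \<le> 1 / (1 - q) * (1 / (1 - q)) ^ n"
  proof (intro mult_mono Suc.IH)
    have "(\<Sum>b\<in>{1..Suc ?m}. q ^ (Suc ?m - b)) = (\<Sum>i<Suc ?m. q ^ i)"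
      by (rule sum.reindex_bij_witness[of _ "\<lambda>i. Suc ?m - i" "\<lambda>b. Suc ?m - b"]) auto
    also have "\<dots> = (1 - q ^ Suc ?m) / (1 - q)"
      using assms by (simp only: sum_gp_strict) simp
    also have "\<dots> \<le> 1 / (1 - q)"
      using assms by (intro divide_right_mono) auto
    finally show "(\<Sum>b\<in>{1..Suc ?m}. q ^ (Suc ?m - b)) \<le> 1 / (1 - q)" .
  qed (use assms in \<open>auto intro!: sum_nonneg\<close>)
  finally show ?case by simp
qed

text \<open>The first-order terms of \<open>exp(- q / (1 + q))\<close> and \<open>1 - q\<close> agree, so that each of the \<open>m\<close>
  factors loses only \<open>2 q\<^sup>2\<close>.\<close>
lemma exp_neg_le_power:
  fixes q :: real
  assumes "0 < q" "q < 1"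
  shows "exp (- (real m * q / (1 + q))) * (1 - 2 * real m * q\<^sup>2) \<le> (1 - q) ^ m"
proof (cases "2 * q\<^sup>2 \<le> 1")
  case True
  \<comment> \<open>The right side equals \<open>1 - 2 * q^2 / (1 + q)\<close>.\<close>
  have "1 - 2 * q\<^sup>2 \<le> (1 - q) * (1 + q / (1 + q))"
    using assms by (simp add: field_simps power2_eq_square)
  also have "\<dots> \<le> (1 - q) * exp (q / (1 + q))"
    using assms by (intro mult_left_mono) (auto simp: exp_ge_add_one_self)
  finally have le: "1 - 2 * q\<^sup>2 \<le> (1 - q) * exp (q / (1 + q))" .
  have "1 - 2 * real m * q\<^sup>2 \<le> (1 - 2 * q\<^sup>2) ^ m"
    using Bernoulli_inequality[of "- 2 * q\<^sup>2" m] True by (simp add: algebra_simps)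
  also have "\<dots> \<le> ((1 - q) * exp (q / (1 + q))) ^ m"
    using le True by (intro power_mono) auto
  also have "\<dots> = (1 - q) ^ m * exp (real m * q / (1 + q))"
    by (simp add: power_mult_distrib exp_of_nat_mult[symmetric])
  finally show ?thesis
    by (simp add: exp_minus field_simps)
next
  case False
  show ?thesis
  proof (cases "m = 0")
    case False
    \<comment> \<open>For large \<open>q\<close> a single factor already loses everything: the left
      side of the claim is not positive.\<close>
    then have "1 * 1 \<le> real m * (2 * q\<^sup>2)"
      using \<open>\<not> 2 * q\<^sup>2 \<le> 1\<close> by (intro mult_mono) auto
    then have "exp (- (real m * q / (1 + q))) * (1 - 2 * real m * q\<^sup>2) \<le> 0"
      by (intro mult_nonneg_nonpos) (auto simp: mult_ac)
    also have "0 \<le> (1 - q) ^ m" using assms by simp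
    finally show ?thesis .
  qed simp
qed

section \<open>Poisson sums, total variation and discrete events\<close>

lemma sums_poisson: "(\<lambda>k. l ^ k / fact k * exp (- l)) sums (1::real)"
  using sums_mult2[OF exp_converges[of l], of "exp (- l)"]
  by (simp add: divide_inverse mult_ac exp_minus)

text \<open>The terms at 0 and 1 vanish, and cancelling \<open>k * (k - 1)\<close> against
  \<open>fact k\<close> leaves \<open>l^2\<close> times the Poisson weights shifted by two.\<close>

lemma sums_poisson_factorial_moment:
  fixes l :: real
  shows "(\<lambda>k. real k * (real k - 1) * (l ^ k / fact k * exp (- l))) sums l\<^sup>2"
proof -
  have *: "real (k + 2) * (real (k + 2) - 1) * (l ^ (k + 2) / fact (k + 2) * exp (- l))
      = l\<^sup>2 * (l ^ k / fact k * exp (- l))" for k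
  proof -
    have "fact (k + 2) = real (k + 2) * (real (k + 2) - 1) * fact k"
      by (simp add: numeral_2_eq_2)
    moreover have "real (k + 2) * (real (k + 2) - 1) \<noteq> 0" by simp
    ultimately show ?thesis
      by (simp add: power_add power2_eq_square divide_simps del: of_nat_add fact_Suc)
  qed
  have "(\<lambda>k. real (k + 2) * (real (k + 2) - 1) * (l ^ (k + 2) / fact (k + 2) * exp (- l)))
      sums (l\<^sup>2 * 1)"
    unfolding * by (intro sums_mult sums_poisson)
  then show ?thesis
    by (subst sums_iff_shift'[of _ 2, symmetric]) (simp add: numeral_2_eq_2)
qed

text \<open>Passing to the complement of \<open>A\<close> reverses the sign of the difference, so a
  one-sided bound over all events controls the absolute value.\<close>

lemma tv_dist_leI:
  assumes "prob_space P" "prob_space Q" "sets P = sets Q"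
    and le: "\<And>A. A \<in> sets P \<Longrightarrow> measure Q A - measure P A \<le> B"
  shows "tv_dist P Q \<le> B"
  unfolding tv_dist_def
proof (rule cSUP_least)
  fix A assume A: "A \<in> sets P"
  interpret P: prob_space P by fact
  interpret Q: prob_space Q by fact
  have "measure Q (space P - A) = 1 - measure Q A"
    using Q.prob_compl[of A] A assms(3) sets_eq_imp_space_eq[OF assms(3)] by simp
  moreover have "measure P (space P - A) = 1 - measure P A"
    using P.prob_compl[of A] A by simp
  ultimately show "\<bar>measure P A - measure Q A\<bar> \<le> B"
    using le[OF A] le[of "space P - A"] A by (simp add: abs_le_iff)
qed (use sets.top in blast)

lemma measurable_count_space_Collect:
  assumes "f \<in> measurable M (count_space X)" "B \<subseteq> X"
  shows "{x \<in> space M. f x \<in> B} \<in> sets M"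
proof -
  have "f -` B \<inter> space M \<in> sets M" using assms by (intro measurable_sets) auto
  also have "f -` B \<inter> space M = {x \<in> space M. f x \<in> B}" by auto
  finally show ?thesis .
qed

text \<open>Countable additivity over the values of \<open>g\<close>. With
  \<open>g k = 2 * k\<close> it indexes the even parts of both laws by the same \<open>k\<close>, so
  that they can be subtracted term by term.\<close>

lemma (in finite_measure) sums_measure_range:
  fixes f :: "'a \<Rightarrow> nat" and g :: "nat \<Rightarrow> nat"
  assumes f: "f \<in> measurable M (count_space UNIV)" and g: "inj g"
  shows "(\<lambda>k. if g k \<in> A then measure M {x \<in> space M. f x = g k} else 0)
    sums measure M {x \<in> space M. f x \<in> A \<inter> range g}"
proof -
  let ?E = "\<lambda>k. {x \<in> space M. f x \<in> A \<inter> {g k}}"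
  have "?E k \<in> sets M" for k
    using f by (rule measurable_count_space_Collect) simp
  moreover have "disjoint_family ?E"
    using injD[OF g] by (fastforce simp: disjoint_family_on_def)
  ultimately have "(\<lambda>k. measure M (?E k)) sums measure M (\<Union>k. ?E k)"
    by (intro finite_measure_UNION) auto
  moreover have "(\<Union>k. ?E k) = {x \<in> space M. f x \<in> A \<inter> range g}" by auto
  moreover have "measure M (?E k) = (if g k \<in> A then measure M {x \<in> space M. f x = g k} else 0)"
    for k
  proof (cases "g k \<in> A")
    case False
    then have "?E k = {}" by auto
    then show ?thesis using False by simp
  qed simp
  ultimately show ?thesis by simp
qed

section \<open>Lower bounds for Mallows probabilities\<close>

lemma mallows_measurable:
  assumes "mallows_distributed M n q w"
  shows "(\<lambda>x. f (w x)) \<in> measurable M (count_space UNIV)"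
  using assms unfolding mallows_distributed_def
  by (auto intro: measurable_compose[where N = "count_space {p. p permutes {1..n}}"])

lemma mallows_prob_subset:
  assumes "prob_space M" and w: "mallows_distributed M n q w"
    and P: "P \<subseteq> {p. p permutes {1..n}}"
  shows "measure M {x \<in> space M. w x \<in> P} = (\<Sum>p\<in>P. measure M {x \<in> space M. w x = p})"
proof -
  interpret prob_space M by fact
  have "finite P" using P by (rule finite_subset) (intro finite_permutations, simp)
  moreover have "{x \<in> space M. w x \<in> X} \<in> sets M" if "X \<subseteq> P" for X
    using w that P unfolding mallows_distributed_def
    by (intro measurable_count_space_Collect[of w M "{p. p permutes {1..n}}"]) auto
  from this[of "{p}" for p] have "(\<lambda>p. {x \<in> space M. w x = p}) ` P \<subseteq> sets M"
    by auto
  moreover have "disjoint_family_on (\<lambda>p. {x \<in> space M. w x = p}) P"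
    by (auto simp: disjoint_family_on_def)
  moreover have "{x \<in> space M. w x \<in> P} = (\<Union>p\<in>P. {x \<in> space M. w x = p})" by auto
  ultimately show ?thesis by (simp only: finite_measure_finite_Union)
qed

text \<open>Total mass 1 identifies \<open>c\<close> as the reciprocal of \<open>?Z\<close>, and
  \<open>sum_inversions_le\<close> bounds \<open>?Z\<close> from above.\<close>

lemma mallows_prob_ge:
  fixes q :: real
  assumes "prob_space M" and w: "mallows_distributed M (Suc m) q w"
    and q: "0 < q" "q < 1" and p: "p permutes {1..Suc m}"
  shows "(1 - q) ^ m * q ^ inversion_number (Suc m) p \<le> measure M {x \<in> space M. w x = p}"
proof -
  interpret prob_space M by fact
  let ?P = "{p. p permutes {1..Suc m}}"
  let ?Z = "\<Sum>p\<in>?P. q ^ inversion_number (Suc m) p"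
  obtain c where c: "measure M {x \<in> space M. w x = p} = c * q ^ inversion_number (Suc m) p"
    if "p \<in> ?P" for p
    using w unfolding mallows_distributed_def by auto
  have "w \<in> measurable M (count_space ?P)" using w unfolding mallows_distributed_def by simp
  then have "{x \<in> space M. w x \<in> ?P} = space M"
    by (auto dest: measurable_space)
  then have "1 = (\<Sum>p\<in>?P. measure M {x \<in> space M. w x = p})"
    using mallows_prob_subset[OF assms(1) w order_refl] prob_space by simp
  also have "\<dots> = c * ?Z"
    by (simp add: c sum_distrib_left)
  finally have Z: "1 = c * ?Z" .
  have "?Z \<ge> 0" using q by (intro sum_nonneg) auto
  with Z have "c > 0" by (metis less_eq_real_def mult_le_0_iff not_le zero_less_one)
  then have "1 \<le> c * (1 / (1 - q)) ^ m"
    using sum_inversions_le[OF q, of m] by (subst Z) (intro mult_left_mono, auto)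
  then have "(1 - q) ^ m \<le> c"
    using q by (simp add: power_one_over field_simps)
  then show ?thesis
    using c[of p] p q by (simp add: mult_right_mono)
qed

text \<open>From the event only the involutions \<open>swap_perm S\<close> with \<open>S\<close>
  sparse of size \<open>k\<close> are kept. Being self-inverse, they contribute \<open>k\<close>
  descents twice.\<close>

lemma mallows_des_prob_ge:
  fixes q :: real
  assumes "prob_space M" and w: "mallows_distributed M (Suc m) q w" and q: "0 < q" "q < 1"
  shows "real ((Suc m - k) choose k) * ((1 - q) ^ m * q ^ k)
    \<le> measure M {x \<in> space M. des (Suc m) (w x) + des (Suc m) (inv (w x)) = 2 * k}"
proof -
  interpret prob_space M by fact
  let ?n = "Suc m"
  let ?W = "\<lambda>p. des ?n p + des ?n (inv p)"
  let ?P = "swap_perm ` sparse_sets ?n k"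
  have P: "?P \<subseteq> {p. p permutes {1..?n}}" using swap_perm_permutes by blast
  have "real ((?n - k) choose k) * ((1 - q) ^ m * q ^ k) \<le> real (card ?P) * ((1 - q) ^ m * q ^ k)"
    using q by (intro mult_right_mono) (auto simp: card_image inj_on_swap_perm card_sparse_sets_ge)
  also have "\<dots> = (\<Sum>p\<in>?P. (1 - q) ^ m * q ^ inversion_number ?n p)"
    by (simp add: sum.reindex inj_on_swap_perm card_image inversion_number_swap_perm)
  also have "\<dots> \<le> (\<Sum>p\<in>?P. measure M {x \<in> space M. w x = p})"
    using P mallows_prob_ge[OF assms] by (intro sum_mono) auto
  also have "\<dots> = measure M {x \<in> space M. w x \<in> ?P}"
    using mallows_prob_subset[OF assms(1) w P] by simp
  also have "\<dots> \<le> measure M {x \<in> space M. ?W (w x) = 2 * k}"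
  proof (rule finite_measure_mono)
    show "{x \<in> space M. w x \<in> ?P} \<subseteq> {x \<in> space M. ?W (w x) = 2 * k}"
      by (auto simp: inv_swap_perm des_swap_perm)
    show "{x \<in> space M. ?W (w x) = 2 * k} \<in> sets M"
      using measurable_count_space_Collect[OF mallows_measurable[OF w, of ?W], of "{2 * k}"]
      by simp
  qed
  finally show ?thesis .
qed

section \<open>Comparison with the Poisson weights and the final bound\<close>

text \<open>For \<open>m = 0\<close> the division by \<open>m\<close> gives \<open>0\<close>, which is harmless as \<open>\<pi>\<close> then vanishes for \<open>k > 0\<close>.\<close>
lemma poisson_minus_le:
  fixes q :: real and m k :: nat
  assumes q: "0 < q" "q < 1"
  defines "l \<equiv> real m * q / (1 + q)"
  defines "\<pi> \<equiv> l ^ k / fact k * exp (- l)"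
  assumes p: "real ((Suc m - k) choose k) * ((1 - q) ^ m * q ^ k) \<le> p"
  shows "\<pi> - p \<le> \<pi> * (2 * real m * q\<^sup>2) + 3 / 2 / real m * (real k * (real k - 1) * \<pi>)"
proof (cases "m = 0")
  case True
  then show ?thesis using p by (cases k) (auto simp: \<pi>_def l_def)
next
  case False
  \<comment> \<open>\<open>d\<close> is the relative loss of the binomial coefficient against
    \<open>real m ^ k / fact k\<close>, and \<open>e\<close> that of \<open>(1 - q) ^ m\<close>
    against \<open>exp (- l)\<close>.\<close>
  define d where "d = 3 / 2 * real k * (real k - 1) / real m"
  define e where "e = 2 * real m * q\<^sup>2"
  have l: "0 \<le> l" using q by (simp add: l_def)
  then have \<pi>: "0 \<le> \<pi>" by (simp add: \<pi>_def)
  have d: "0 \<le> d" by (cases k) (auto simp: d_def)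
  have e: "0 \<le> e" by (simp add: e_def)
  have "0 \<le> real ((Suc m - k) choose k) * ((1 - q) ^ m * q ^ k)" using q by simp
  then have p0: "0 \<le> p" using p by linarith
  have "\<pi> * (1 - d - e) \<le> p"
  \<comment> \<open>If one loss reaches 1, the lower bound is not positive and is trivial. Otherwise
    \<open>1 - d\<close> and \<open>1 - e\<close> are positive and the two estimates can be
    multiplied.\<close>
  proof (cases "1 \<le> d \<or> 1 \<le> e")
    case True
    then have "1 - d - e \<le> 0" using d e by linarith
    then have "\<pi> * (1 - d - e) \<le> 0" using \<pi> by (intro mult_nonneg_nonpos)
    then show ?thesis using p0 by simp
  next
    case False
    \<comment> \<open>Only the power of \<open>l\<close> is enlarged; \<open>exp (- l)\<close> stays
      for the comparison with \<open>(1 - q) ^ m\<close>.\<close>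
    have "l \<le> real m * q"
      using q by (simp add: l_def divide_le_eq field_simps)
    then have "\<pi> \<le> real m ^ k * q ^ k / fact k * exp (- l)"
      unfolding \<pi>_def using l
      by (intro mult_right_mono divide_right_mono) (auto simp: power_mono simp flip: power_mult_distrib)
    moreover have "1 - d - e \<le> (1 - d) * (1 - e)"
      using mult_nonneg_nonneg[OF d e] by (simp add: algebra_simps)
    ultimately have "\<pi> * (1 - d - e) \<le> (real m ^ k * q ^ k / fact k * exp (- l)) * ((1 - d) * (1 - e))"
      using \<pi> False q by (intro order_trans[OF mult_left_mono mult_right_mono]) auto
    also have "\<dots> = ((1 - d) * real m ^ k) * (exp (- l) * (1 - e)) * (q ^ k / fact k)"
      by simp
    also have "\<dots> \<le> (real ((Suc m - k) choose k) * fact k) * (1 - q) ^ m * (q ^ k / fact k)"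
    proof (rule mult_right_mono[OF mult_mono])
      show "(1 - d) * real m ^ k \<le> real ((Suc m - k) choose k) * fact k"
        using prod_diff_ge[of "Suc m" k] \<open>m \<noteq> 0\<close> by (simp add: d_def)
      show "exp (- l) * (1 - e) \<le> (1 - q) ^ m"
        using exp_neg_le_power[OF q, of m] by (simp add: l_def e_def)
    qed (use q False in auto)
    also have "\<dots> = real ((Suc m - k) choose k) * ((1 - q) ^ m * q ^ k)"
      by simp
    finally show ?thesis using p by linarith
  qed
  then have "\<pi> - p \<le> \<pi> * e + d * \<pi>" by (simp add: algebra_simps)
  then show ?thesis by (simp add: d_def e_def mult.assoc)
qed

theorem proposition7p6:
  fixes n :: nat and q :: real
    and M :: "'a measure" and w :: "'a \<Rightarrow> nat \<Rightarrow> nat"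
    and M' :: "'b measure" and N :: "'b \<Rightarrow> nat"
  assumes "n \<ge> 1" and "0 < q" and "q \<le> 1"
    and "prob_space M" and "mallows_distributed M n q w"
    and "prob_space M'" and "poisson_distributed M' ((real n - 1) * q / (1 + q)) N"
  shows "tv_dist (distr M (count_space UNIV) (\<lambda>x. des n (w x) + des n (inv (w x))))
                 (distr M' (count_space UNIV) (\<lambda>x. 2 * N x))
         \<le> 12 * q\<^sup>2 * real n"
proof -
  interpret M: prob_space M by fact
  interpret M': prob_space M' by fact
  let ?W = "\<lambda>x. des n (w x) + des n (inv (w x))"
  let ?N = "\<lambda>x. 2 * N x"
  obtain m where n: "n = Suc m" using assms(1) by (cases n) auto
  define l where "l = real m * q / (1 + q)"
  have W: "?W \<in> measurable M (count_space UNIV)"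
    using assms(5) by (rule mallows_measurable)
  have "N \<in> measurable M' (count_space UNIV)"
    and Nk: "measure M' {x \<in> space M'. N x = k} = l ^ k / fact k * exp (- l)" for k
    using assms(7) by (auto simp: poisson_distributed_def n l_def)
  then have N2k: "measure M' {x \<in> space M'. 2 * N x = 2 * k} = l ^ k / fact k * exp (- l)" for k
    by simp
  have N: "?N \<in> measurable M' (count_space UNIV)"
    using \<open>N \<in> measurable M' (count_space UNIV)\<close> by (auto intro: measurable_compose)
  have inj: "inj (\<lambda>k::nat. 2 * k)" by (simp add: inj_def)
  show ?thesis
  proof (rule tv_dist_leI)
    show "prob_space (distr M (count_space UNIV) ?W)" using W by (rule M.prob_space_distr)
    show "prob_space (distr M' (count_space UNIV) ?N)" using N by (rule M'.prob_space_distr)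
    fix A :: "nat set"
    let ?P = "measure (distr M (count_space UNIV) ?W) A"
    let ?Q = "measure (distr M' (count_space UNIV) ?N) A"
    have P: "?P = measure M {x \<in> space M. ?W x \<in> A}"
      using W by (simp add: measure_distr vimage_def Int_def conj_ac)
    have Q: "?Q = measure M' {x \<in> space M'. ?N x \<in> A}"
      using N by (simp add: measure_distr vimage_def Int_def conj_ac)
    show "?Q - ?P \<le> 12 * q\<^sup>2 * real n"
    proof (cases "q < 1")
      case False
      then have "q = 1" using assms(3) by simp
      moreover have "?Q \<le> 1" unfolding Q by simp
      moreover have "0 \<le> ?P" by (rule measure_nonneg)
      ultimately have "?Q - ?P \<le> 1" "12 * q\<^sup>2 * real n = 12 * real n" by (linarith, simp)
      then show ?thesis using assms(1) by linarith
    next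
      case True
      let ?p = "\<lambda>k. measure M {x \<in> space M. ?W x = 2 * k}"
      let ?\<pi> = "\<lambda>k. l ^ k / fact k * exp (- l)"
      \<comment> \<open>Discarding the odd values only lowers the Mallows probability, so bounding
        \<open>?Q - ?P'\<close> is enough.\<close>
      let ?P' = "measure M {x \<in> space M. ?W x \<in> A \<inter> range (\<lambda>k. 2 * k)}"
      let ?b = "\<lambda>k. ?\<pi> k * (2 * real m * q\<^sup>2) + 3 / 2 / real m * (real k * (real k - 1) * ?\<pi> k)"
      \<comment> \<open>Nothing is lost here, as \<open>2 * N\<close> takes only even
        values.\<close>
      have "(\<lambda>k. if 2 * k \<in> A then ?\<pi> k else 0) sums ?Q"
        using M'.sums_measure_range[OF N inj, of A] unfolding N2k Q by simp
      moreover have "(\<lambda>k. if 2 * k \<in> A then ?p k else 0) sums ?P'"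
        using M.sums_measure_range[OF W inj, of A] by simp
      ultimately have "(\<lambda>k. (if 2 * k \<in> A then ?\<pi> k else 0) - (if 2 * k \<in> A then ?p k else 0))
          sums (?Q - ?P')"
        by (rule sums_diff)
      also have "(\<lambda>k. (if 2 * k \<in> A then ?\<pi> k else 0) - (if 2 * k \<in> A then ?p k else 0))
          = (\<lambda>k. if 2 * k \<in> A then ?\<pi> k - ?p k else 0)"
        by auto
      finally have diff: "(\<lambda>k. if 2 * k \<in> A then ?\<pi> k - ?p k else 0) sums (?Q - ?P')" .
      \<comment> \<open>Total mass 1 for the first summand, second factorial moment
        \<open>l^2\<close> for the other.\<close>
      have bound: "?b sums (1 * (2 * real m * q\<^sup>2) + 3 / 2 / real m * l\<^sup>2)"
        by (intro sums_add sums_mult sums_mult2 sums_poisson sums_poisson_factorial_moment)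
      have "(if 2 * k \<in> A then ?\<pi> k - ?p k else 0) \<le> ?b k" for k
      proof -
        have "?\<pi> k - ?p k \<le> ?b k"
          unfolding l_def using mallows_des_prob_ge[of M m q w k] assms True
          by (intro poisson_minus_le) (auto simp: n)
        \<comment> \<open>This covers the indices with \<open>2 * k \<notin> A\<close>, where the
          summand is 0.\<close>
        moreover have "0 \<le> ?b k"
        proof -
          have \<pi>: "0 \<le> ?\<pi> k" using assms(2) by (simp add: l_def)
          have "0 \<le> real k * (real k - 1)" by (cases k) auto
          then have "0 \<le> 3 / 2 / real m * (real k * (real k - 1) * ?\<pi> k)"
            using \<pi> by (intro mult_nonneg_nonneg[of "3 / 2 / real m"] mult_nonneg_nonneg[OF _ \<pi>]) simp
          moreover have "0 \<le> ?\<pi> k * (2 * real m * q\<^sup>2)" by (rule mult_nonneg_nonneg[OF \<pi>]) simp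
          ultimately show ?thesis by linarith
        qed
        ultimately show ?thesis by simp
      qed
      then have "?Q - ?P' \<le> 1 * (2 * real m * q\<^sup>2) + 3 / 2 / real m * l\<^sup>2"
        using diff bound by (rule sums_le)
      also have "\<dots> \<le> 2 * real m * q\<^sup>2 + 3 / 2 * real m * q\<^sup>2"
      proof -
        have "l \<le> real m * q" "0 \<le> l"
          using assms(2) by (auto simp: l_def divide_le_eq field_simps)
        \<comment> \<open>One factor \<open>real m\<close> of the square cancels; for
          \<open>m = 0\<close> the division by zero yields 0 on both sides.\<close>
        then have "3 / 2 / real m * l\<^sup>2 \<le> 3 / 2 / real m * (real m * q)\<^sup>2"
          by (intro mult_left_mono power_mono) auto
        then show ?thesis by (simp add: power2_eq_square mult_ac split: if_splits)
      qed
      \<comment> \<open>The constant reached is \<open>7 / 2\<close>, with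
        \<open>real m = real n - 1\<close> in place of \<open>real n\<close>.\<close>
      also have "\<dots> \<le> 12 * q\<^sup>2 * real n"
        by (simp add: n algebra_simps)
      finally have "?Q - ?P' \<le> 12 * q\<^sup>2 * real n" .
      moreover have "?P' \<le> ?P"
        unfolding P
        by (intro M.finite_measure_mono measurable_count_space_Collect[OF W]) auto
      ultimately show ?thesis by linarith
    qed
  qed simp
qed

end
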